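(* Let $(\mathfrak g,[\cdot,\cdot],\alpha)$ be a Hom-Lie algebra over $\mathbb K$. If there exists a bilinear form $B:\mathfrak g\times\mathfrak g\to\mathbb K$ such that $(\mathfrak g,[\cdot,\cdot],\alpha,B)$ is a quadratic Hom-Lie algebra, then (1) $(\mathfrak g^*,\widetilde{\mathrm{ad}},\widetilde\alpha)$ is a representation of $\mathfrak g$; (2) the representations $(\mathfrak g,\mathrm{ad},\alpha)$ and $(\mathfrak g^*,\widetilde{\mathrm{ad}},\widetilde\alpha)$ are isomorphic. Here $\mathrm{ad}(x)(y)=[x,y]$, $\widetilde{\mathrm{ad}}(x)(f)=-f\circ\mathrm{ad}(x)$ and $\widetilde\alpha(f)=f\circ\alpha$ for $x,y\in\mathfrak g$, $f\in\mathfrak g^*$.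
   Context: $\mathbb K$ is an algebraically closed field of characteristic $0$. A Hom-Lie algebra is a triple $(\mathfrak g,[\cdot,\cdot],\alpha)$ with $[\cdot,\cdot]$ a skew-symmetric bilinear bracket on the $\mathbb K$-vector space $\mathfrak g$ and $\alpha:\mathfrak g\to\mathfrak g$ a linear map such that $[\alpha(x),[y,z]]+[\alpha(y),[z,x]]+[\alpha(z),[x,y]]=0$ for all $x,y,z$. It is quadratic with form $B$ if $B$ is a symmetric nondegenerate bilinear form with $B([x,y],z)=B(x,[y,z])$ and $B(\alpha(x),y)=B(x,\alpha(y))$ for all $x,y,z$. A representation of $\mathfrak g$ is a triple $(V,\rho,\beta)$ with $V$ a $\mathbb K$-vector space, $\beta\in\mathrm{End}(V)$ and $\rho:\mathfrak g\to\mathrm{End}(V)$ linear with $\rho([x,y])\circ\beta=\rho(\alpha(x))\circ\rho(y)-\rho(\alpha(y))\circ\rho(x)$ for all $x,y\in\mathfrak g$. Two representations $(V,\rho,\beta)$, $(V',\rho',\beta')$ are isomorphic if there is a bijective linear map $\phi:V\to V'$ with $\rho'(x)\circ\phi=\phi\circ\rho(x)$ for all $x\in\mathfrak g$ and $\phi\circ\beta=\beta'\circ\phi$. $\mathfrak g^*$ denotes the dual vector space of $\mathfrak g$.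
   Formalization: Part (2) is stated for finite-dimensional g only; it fails for every infinite-dimensional g, since then dim g* > dim g (e.g. abelian g, zero α, B the dot product in a basis). Part (1) is stated in any dimension. *)

theory Defs
  imports
    "HOL-Computational_Algebra.Polynomial"
    "HOL-Library.Function_Algebras"
begin

locale hom_lie_algebra = vector_space scale
  for scale :: "'k::field \<Rightarrow> 'g::ab_group_add \<Rightarrow> 'g" +
  fixes bracket :: "'g \<Rightarrow> 'g \<Rightarrow> 'g"
    and \<alpha> :: "'g \<Rightarrow> 'g"
  assumes bracket_linear_right: "Vector_Spaces.linear scale scale (\<lambda>y. bracket x y)"
    and bracket_linear_left: "Vector_Spaces.linear scale scale (\<lambda>x. bracket x y)"
    and bracket_skew: "bracket x y = - bracket y x"
    and \<alpha>_linear: "Vector_Spaces.linear scale scale \<alpha>"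
    and hom_jacobi:
      "bracket (\<alpha> x) (bracket y z) + bracket (\<alpha> y) (bracket z x) + bracket (\<alpha> z) (bracket x y) = 0"

locale quadratic_hom_lie_algebra = hom_lie_algebra scale bracket \<alpha>
  for scale :: "'k::field \<Rightarrow> 'g::ab_group_add \<Rightarrow> 'g"
    and bracket :: "'g \<Rightarrow> 'g \<Rightarrow> 'g"
    and \<alpha> :: "'g \<Rightarrow> 'g" +
  fixes B :: "'g \<Rightarrow> 'g \<Rightarrow> 'k"
  assumes form_linear_right: "Vector_Spaces.linear scale (*) (\<lambda>y. B x y)"
    and form_linear_left: "Vector_Spaces.linear scale (*) (\<lambda>x. B x y)"
    and form_symmetric: "B x y = B y x"
    and form_nondegenerate: "(\<And>y. B x y = 0) \<Longrightarrow> x = 0"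
    and form_invariant: "B (bracket x y) z = B x (bracket y z)"
    and form_\<alpha>: "B (\<alpha> x) y = B x (\<alpha> y)"

text \<open>
  The dual space depends on the scalar multiplication, so it is a set of functions rather than a
  type. The underlying space of a representation is therefore a subspace \<open>V\<close> of the vector space
  carried by a type (\<open>V = UNIV\<close> being allowed); maps on \<open>V\<close> are total functions whose values
  outside \<open>V\<close> are irrelevant.
\<close>

definition linear_between ::
    "('k::field \<Rightarrow> 'v::ab_group_add \<Rightarrow> 'v) \<Rightarrow> ('k \<Rightarrow> 'w::ab_group_add \<Rightarrow> 'w) \<Rightarrow>
     'v set \<Rightarrow> 'w set \<Rightarrow> ('v \<Rightarrow> 'w) \<Rightarrow> bool"
  where "linear_between s1 s2 V W f \<longleftrightarrow>
    (\<forall>v\<in>V. f v \<in> W) \<and>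
    (\<forall>u\<in>V. \<forall>v\<in>V. f (u + v) = f u + f v) \<and>
    (\<forall>c. \<forall>v\<in>V. f (s1 c v) = s2 c (f v))"

locale hom_lie_representation =
  hom_lie_algebra scale bracket \<alpha> + V: vector_space scaleV
  for scale :: "'k::field \<Rightarrow> 'g::ab_group_add \<Rightarrow> 'g"
    and bracket :: "'g \<Rightarrow> 'g \<Rightarrow> 'g"
    and \<alpha> :: "'g \<Rightarrow> 'g"
    and scaleV :: "'k \<Rightarrow> 'v::ab_group_add \<Rightarrow> 'v" +
  fixes V :: "'v set"
    and \<rho> :: "'g \<Rightarrow> 'v \<Rightarrow> 'v"
    and \<beta> :: "'v \<Rightarrow> 'v"
  assumes subspace_V: "V.subspace V"
    and \<beta>_End: "linear_between scaleV scaleV V V \<beta>"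
    and \<rho>_End: "linear_between scaleV scaleV V V (\<rho> x)"
    and \<rho>_linear: "v \<in> V \<Longrightarrow> Vector_Spaces.linear scale scaleV (\<lambda>x. \<rho> x v)"
    and \<rho>_bracket:
      "v \<in> V \<Longrightarrow> \<rho> (bracket x y) (\<beta> v) = \<rho> (\<alpha> x) (\<rho> y v) - \<rho> (\<alpha> y) (\<rho> x v)"

definition isomorphic_representations ::
    "('k::field \<Rightarrow> 'v::ab_group_add \<Rightarrow> 'v) \<Rightarrow> 'v set \<Rightarrow> ('g \<Rightarrow> 'v \<Rightarrow> 'v) \<Rightarrow> ('v \<Rightarrow> 'v) \<Rightarrow>
     ('k \<Rightarrow> 'w::ab_group_add \<Rightarrow> 'w) \<Rightarrow> 'w set \<Rightarrow> ('g \<Rightarrow> 'w \<Rightarrow> 'w) \<Rightarrow> ('w \<Rightarrow> 'w) \<Rightarrow> bool"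
  where "isomorphic_representations s V \<rho> \<beta> s' V' \<rho>' \<beta>' \<longleftrightarrow>
    (\<exists>\<phi>. linear_between s s' V V' \<phi> \<and> bij_betw \<phi> V V' \<and>
      (\<forall>x. \<forall>v\<in>V. \<rho>' x (\<phi> v) = \<phi> (\<rho> x v)) \<and>
      (\<forall>v\<in>V. \<phi> (\<beta> v) = \<beta>' (\<phi> v)))"

definition dual_space :: "('k::field \<Rightarrow> 'g::ab_group_add \<Rightarrow> 'g) \<Rightarrow> ('g \<Rightarrow> 'k) set"
  where "dual_space scale = {f. Vector_Spaces.linear scale (*) f}"

definition dual_scale :: "'k::field \<Rightarrow> ('g \<Rightarrow> 'k) \<Rightarrow> ('g \<Rightarrow> 'k)"
  where "dual_scale c f = (\<lambda>x. c * f x)"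

definition ad :: "('g \<Rightarrow> 'g \<Rightarrow> 'g) \<Rightarrow> 'g \<Rightarrow> 'g \<Rightarrow> 'g"
  where "ad bracket x y = bracket x y"

definition coad :: "('g \<Rightarrow> 'g \<Rightarrow> 'g) \<Rightarrow> 'g \<Rightarrow> ('g \<Rightarrow> 'k::field) \<Rightarrow> ('g \<Rightarrow> 'k)"
  where "coad bracket x f = - (f \<circ> ad bracket x)"

definition dual_map :: "('g \<Rightarrow> 'g) \<Rightarrow> ('g \<Rightarrow> 'k::field) \<Rightarrow> ('g \<Rightarrow> 'k)"
  where "dual_map \<alpha> f = f \<circ> \<alpha>"

end

theory Submission
  imports Defs
begin

text \<open>
  The form \<open>B\<close> gives the intertwiner \<open>v \<mapsto> B v\<close> from \<open>\<gg>\<close> into its dual. It is injective by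
  nondegeneracy, hence bijective for dimension reasons if \<open>\<gg>\<close> is finite-dimensional. In any
  dimension, \<open>coad\<close> is a representation as soon as
  \<open>\<alpha> [[x, y], z] = [x, [\<alpha> y, z]] - [y, [\<alpha> x, z]]\<close>, and pairing both sides with \<open>w\<close> under \<open>B\<close>
  turns this identity into the Hom-Jacobi identity for \<open>x, y, w\<close>.
\<close>

lemma vector_space_dual_scale: "vector_space (dual_scale :: 'k::field \<Rightarrow> ('g \<Rightarrow> 'k) \<Rightarrow> 'g \<Rightarrow> 'k)"
  by unfold_locales (auto simp: dual_scale_def fun_eq_iff algebra_simps)

lemma vector_space_mult: "vector_space ((*) :: 'k::field \<Rightarrow> 'k \<Rightarrow> 'k)"
  by unfold_locales (auto simp: algebra_simps)

lemma sum_apply: "(\<Sum>i\<in>A. f i) x = (\<Sum>i\<in>A. f i x)"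
  for f :: "'i \<Rightarrow> 'g \<Rightarrow> 'k::comm_monoid_add"
  by (induction A rule: infinite_finite_induct) auto

text \<open>Operations on functionals are pointwise, so linearity can be tested one argument at a
  time. This serves both \<open>coad\<close> in its first argument and the form
  \<open>B\<close>.\<close>

lemma linear_dual_scale_iff:
  assumes "vector_space (scale :: 'k::field \<Rightarrow> 'g::ab_group_add \<Rightarrow> 'g)"
  shows "Vector_Spaces.linear scale dual_scale \<phi> \<longleftrightarrow>
    (\<forall>y. Vector_Spaces.linear scale (*) (\<lambda>x. \<phi> x y))"
  using assms vector_space_dual_scale[where 'k='k] vector_space_mult[where 'k='k]
  by (auto simp: Vector_Spaces.linear_iff dual_scale_def fun_eq_iff)

lemma subspace_dual_space:
  assumes "vector_space scale"
  shows "module.subspace dual_scale (dual_space scale)"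
proof -
  interpret D: vector_space dual_scale by (rule vector_space_dual_scale)
  show ?thesis
    using assms unfolding D.subspace_def
    by (auto simp: dual_space_def Vector_Spaces.linear_iff dual_scale_def algebra_simps
        vector_space_mult)
qed

text \<open>Expanding x in the basis gives f as the combination of coordinate functionals with
  coefficients \<open>f b\<close>. This bounds the dimension of the dual by
  \<open>card Basis\<close>.\<close>

lemma (in finite_dimensional_vector_space) dual_space_subset_span_coordinates:
  "dual_space scale \<subseteq>
     module.span dual_scale ((\<lambda>b x. representation Basis x b) ` Basis)"
proof
  interpret D: vector_space "dual_scale :: 'a \<Rightarrow> ('b \<Rightarrow> 'a) \<Rightarrow> 'b \<Rightarrow> 'a" by (rule vector_space_dual_scale)
  fix f assume "f \<in> dual_space scale"
  then interpret f: Vector_Spaces.linear scale "(*)" f by (simp add: dual_space_def)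
  have "f = (\<Sum>b\<in>Basis. dual_scale (f b) (\<lambda>x. representation Basis x b))"
  proof
    fix x
    have "f x = f (\<Sum>b\<in>Basis. scale (representation Basis x b) b)"
      using sum_representation_eq[OF independent_Basis _ finite_Basis order_refl] span_Basis by simp
    then show "f x = (\<Sum>b\<in>Basis. dual_scale (f b) (\<lambda>x. representation Basis x b)) x"
      by (simp add: f.sum f.scale dual_scale_def sum_apply mult.commute)
  qed
  also have "\<dots> \<in> D.span ((\<lambda>b x. representation Basis x b) ` Basis)"
    by (intro D.span_sum D.span_scale D.span_base imageI)
  finally show "f \<in> D.span ((\<lambda>b x. representation Basis x b) ` Basis)" .
qed

text \<open>A functional outside the range, together with the images of the basis, would give
  \<open>card Basis + 1\<close> independent vectors in the span of at most \<open>card Basis\<close>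
  coordinate functionals. The count takes place inside that span because the type of all functions
  may have infinite dimension.\<close>

lemma (in finite_dimensional_vector_space) dual_space_subset_range:
  assumes "Vector_Spaces.linear scale dual_scale \<phi>" "inj \<phi>" "range \<phi> \<subseteq> dual_space scale"
  shows "dual_space scale \<subseteq> range \<phi>"
proof (rule ccontr)
  interpret D: vector_space "dual_scale :: 'a \<Rightarrow> ('b \<Rightarrow> 'a) \<Rightarrow> 'b \<Rightarrow> 'a" by (rule vector_space_dual_scale)
  interpret \<phi>: Vector_Spaces.linear scale dual_scale \<phi> by fact
  assume "\<not> dual_space scale \<subseteq> range \<phi>"
  then obtain f where f: "f \<in> dual_space scale" "f \<notin> range \<phi>" by blast
  let ?C = "(\<lambda>b x. representation Basis x b) ` Basis"
  have span: "D.span (\<phi> ` Basis) = range \<phi>"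
    using \<phi>.span_image span_Basis by simp
  have "D.independent (\<phi> ` Basis)"
    using \<phi>.independent_inj_image independent_Basis assms(2) by blast
  then have ind: "D.independent (insert f (\<phi> ` Basis))"
    using f(2) span by (simp add: D.independent_insert)
  have sub: "insert f (\<phi> ` Basis) \<subseteq> D.span ?C"
    using dual_space_subset_span_coordinates f(1) assms(3) by blast
  have "card (insert f (\<phi> ` Basis)) \<le> card ?C"
    using D.independent_span_bound[OF _ ind sub] finite_Basis by simp
  also have "\<dots> \<le> card Basis"
    by (rule card_image_le[OF finite_Basis])
  \<comment> \<open>Injectivity keeps the image of the basis at \<open>card Basis\<close> elements,
    and \<open>f\<close> adds one more.\<close>
  finally show False
    using f(2) finite_Basis card_image[OF inj_on_subset[OF assms(2) subset_UNIV], of Basis]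
    by (auto simp: card_insert_if split: if_splits)
qed

context hom_lie_algebra
begin

sublocale bracket_right: Vector_Spaces.linear scale scale "\<lambda>y. bracket x y" for x
  by (rule bracket_linear_right)

sublocale bracket_left: Vector_Spaces.linear scale scale "\<lambda>x. bracket x y" for y
  by (rule bracket_linear_left)

sublocale \<alpha>: Vector_Spaces.linear scale scale \<alpha>
  by (rule \<alpha>_linear)

lemma ad_representation: "hom_lie_representation scale bracket \<alpha> scale UNIV (ad bracket) \<alpha>"
proof (intro hom_lie_representation.intro hom_lie_representation_axioms.intro)
  show "hom_lie_algebra scale bracket \<alpha>" by (rule hom_lie_algebra_axioms)
  show "vector_space scale" by (rule vector_space_axioms)
  show "subspace UNIV" by simp
  show "linear_between scale scale UNIV UNIV \<alpha>"
    by (simp add: linear_between_def \<alpha>.add \<alpha>.scale)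
  show "linear_between scale scale UNIV UNIV (ad bracket x)" for x
    by (simp add: linear_between_def ad_def bracket_right.add bracket_right.scale)
  show "Vector_Spaces.linear scale scale (\<lambda>x. ad bracket x v)" for v
    unfolding ad_def by (rule bracket_linear_left)
  show "ad bracket (bracket x y) (\<alpha> v) = ad bracket (\<alpha> x) (ad bracket y v) - ad bracket (\<alpha> y) (ad bracket x v)"
    for x y v
  proof -
    have "bracket (\<alpha> x) (bracket y v) - bracket (\<alpha> y) (bracket x v) - bracket (bracket x y) (\<alpha> v) = 0"
      using hom_jacobi[of x y v]
      by (simp add: bracket_skew[of v x] bracket_skew[of "bracket x y" "\<alpha> v"] bracket_right.neg)
    then show ?thesis by (simp add: ad_def)
  qed
qed

text \<open>Precomposition reverses the order of composition, and the two signs in a double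
  \<open>coad\<close> cancel. The representation identity at f is therefore the assumed identity
  with -f applied to both sides.\<close>

lemma coad_representation:
  assumes "\<And>x y z. \<alpha> (bracket (bracket x y) z) = bracket x (bracket (\<alpha> y) z) - bracket y (bracket (\<alpha> x) z)"
  shows "hom_lie_representation scale bracket \<alpha>
    dual_scale (dual_space scale) (coad bracket) (dual_map \<alpha>)"
proof (intro hom_lie_representation.intro hom_lie_representation_axioms.intro)
  show "hom_lie_algebra scale bracket \<alpha>" by (rule hom_lie_algebra_axioms)
  show "vector_space (dual_scale :: 'k \<Rightarrow> ('g \<Rightarrow> 'k) \<Rightarrow> 'g \<Rightarrow> 'k)" by (rule vector_space_dual_scale)
  show "module.subspace dual_scale (dual_space scale)"
    by (rule subspace_dual_space[OF vector_space_axioms])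
  note D = dual_space_def Vector_Spaces.linear_iff vector_space_axioms
    vector_space_mult vector_space_dual_scale linear_between_def dual_scale_def coad_def ad_def
    dual_map_def fun_eq_iff bracket_right.add bracket_right.scale bracket_left.add bracket_left.scale
    \<alpha>.add \<alpha>.scale
  show "linear_between dual_scale dual_scale (dual_space scale) (dual_space scale) (dual_map \<alpha>)"
    by (auto simp: D)
  show "linear_between dual_scale dual_scale (dual_space scale) (dual_space scale) (coad bracket x)" for x
    by (auto simp: D)
  fix f :: "'g \<Rightarrow> 'k" assume f: "f \<in> dual_space scale"
  then show "Vector_Spaces.linear scale dual_scale (\<lambda>x. coad bracket x f)"
    unfolding linear_dual_scale_iff[OF vector_space_axioms] by (auto simp: D)
  interpret f: Vector_Spaces.linear scale "(*)" f using f by (simp add: dual_space_def)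
  show "coad bracket (bracket x y) (dual_map \<alpha> f) =
      coad bracket (\<alpha> x) (coad bracket y f) - coad bracket (\<alpha> y) (coad bracket x f)" for x y
    by (simp add: coad_def ad_def dual_map_def fun_eq_iff assms f.diff)
qed

end

context quadratic_hom_lie_algebra
begin

sublocale form_right: Vector_Spaces.linear scale "(*)" "\<lambda>y. B x y" for x
  by (rule form_linear_right)

sublocale form_left: Vector_Spaces.linear scale "(*)" "\<lambda>x. B x y" for y
  by (rule form_linear_left)

lemma form_eqI: "x = y" if "\<And>z. B x z = B y z"
  using form_nondegenerate[of "x - y"] that by (simp add: form_left.diff)

text \<open>Each \<open>ad bracket x\<close> is skew-adjoint for \<open>B\<close>. Read with z as
  the argument, this says that \<open>B\<close> intertwines \<open>ad\<close> and
  \<open>coad\<close>.\<close>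

lemma form_ad: "B (bracket x y) z = - B y (bracket x z)"
  using form_invariant[of y x z] bracket_skew[of x y] by (simp add: form_left.neg)

lemma \<alpha>_bracket_bracket:
  "\<alpha> (bracket (bracket x y) z) = bracket x (bracket (\<alpha> y) z) - bracket y (bracket (\<alpha> x) z)"
proof (rule form_eqI)
  fix w
  \<comment> \<open>This is Hom-Jacobi for x, y, w, in the form in which \<open>ad\<close> satisfies
    the representation identity.\<close>
  have "bracket (bracket x y) (\<alpha> w) = bracket (\<alpha> x) (bracket y w) - bracket (\<alpha> y) (bracket x w)"
    using hom_lie_representation.\<rho>_bracket[OF ad_representation] by (simp add: ad_def)
  \<comment> \<open>Every map is moved from z over to w: \<alpha> is self-adjoint and brackets are
    skew-adjoint. Taking adjoints reverses the order, so [x, [\<alpha> y, z]] against w becomes z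
    against [\<alpha> y, [x, w]], with \<alpha> on the outer factor as in Hom-Jacobi.\<close>
  then show "B (\<alpha> (bracket (bracket x y) z)) w =
      B (bracket x (bracket (\<alpha> y) z) - bracket y (bracket (\<alpha> x) z)) w"
    by (simp add: form_\<alpha> form_ad form_left.diff form_right.diff)
qed

lemma linear_form: "Vector_Spaces.linear scale dual_scale B"
  by (simp add: linear_dual_scale_iff[OF vector_space_axioms] form_linear_left)

lemma inj_form: "inj B"
  by (auto intro!: injI form_eqI)

lemma ad_coad_isomorphic:
  assumes "finite_dimensional_vector_space scale Basis"
  shows "isomorphic_representations scale UNIV (ad bracket) \<alpha>
    dual_scale (dual_space scale) (coad bracket) (dual_map \<alpha>)"
proof -
  have range: "range B \<subseteq> dual_space scale"
    by (auto simp: dual_space_def form_linear_right)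
  interpret form: Vector_Spaces.linear scale dual_scale B by (rule linear_form)
  have "linear_between scale dual_scale UNIV (dual_space scale) B"
    using range by (auto simp: linear_between_def form.add form.scale)
  \<comment> \<open>Finite dimension enters here, to make the injective map \<open>B\<close>
    surjective onto the dual.\<close>
  moreover have "bij_betw B UNIV (dual_space scale)"
    using inj_form range
      finite_dimensional_vector_space.dual_space_subset_range[OF assms linear_form inj_form range]
    by (auto simp: bij_betw_def)
  ultimately show ?thesis
    unfolding isomorphic_representations_def
    by (intro exI[of _ B]) (auto simp: coad_def ad_def dual_map_def fun_eq_iff form_ad form_\<alpha>)
qed

end

text \<open>The isomorphism is conditional on a finite basis because an infinite-dimensional space
  is never isomorphic to its full dual. That \<open>ad\<close> is a representation is stated
  separately since \<open>isomorphic_representations\<close> does not include it.\<close>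

theorem proposition3p3:
  fixes scale :: "'k::{alg_closed_field, field_char_0} \<Rightarrow> 'g::ab_group_add \<Rightarrow> 'g"
    and bracket :: "'g \<Rightarrow> 'g \<Rightarrow> 'g"
    and \<alpha> :: "'g \<Rightarrow> 'g"
  assumes "hom_lie_algebra scale bracket \<alpha>"
    and "\<exists>B. quadratic_hom_lie_algebra scale bracket \<alpha> B"
  shows "hom_lie_representation scale bracket \<alpha>
           dual_scale (dual_space scale) (coad bracket) (dual_map \<alpha>) \<and>
         hom_lie_representation scale bracket \<alpha> scale UNIV (ad bracket) \<alpha> \<and>
         ((\<exists>Basis. finite_dimensional_vector_space scale Basis) \<longrightarrow>
           isomorphic_representations
             scale UNIV (ad bracket) \<alpha>
             dual_scale (dual_space scale) (coad bracket) (dual_map \<alpha>))"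
proof -
  interpret hom_lie_algebra scale bracket \<alpha> by fact
  obtain B where "quadratic_hom_lie_algebra scale bracket \<alpha> B" using assms(2) ..
  then interpret quadratic_hom_lie_algebra scale bracket \<alpha> B .
  show ?thesis
    using coad_representation[OF \<alpha>_bracket_bracket] ad_representation ad_coad_isomorphic by blast
qed

end
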